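(* Let $\mathcal J$ be an ideal on $\omega$ which is a $P^+(\mathcal J)$-ideal and is $\le_{KB}$-homogeneous. (1) Assume CH. The following conditions are equivalent: (a) $\mathcal{ED}_{\mathrm{Fin}}\not\le_{KB}\mathcal J$; (b) there is a Q-point which is not a $\mathcal J$-point; (c) there is a Q-point which is not a weak $\mathcal J$-ultrafilter. (2) If $\mathcal J$ is $F_\sigma$, then CH can be relaxed to the assumption $\mathfrak p=\mathfrak c$ in (1).
   Context: An ideal on a set $X$ is a family of subsets of $X$ closed under finite unions and subsets, containing all finite subsets of $X$ and not containing $X$; $\mathcal J^+=\mathcal P(X)\setminus\mathcal J$. $F_\sigma$ refers to the topology of $\mathcal P(\omega)\cong\{0,1\}^\omega$. $\mathfrak c=2^{\aleph_0}$, and $\mathfrak p$ is the usual pseudointersection number. With $\Delta=\{(n,k)\in\omega^2:n\ge k\}$, $\mathcal{ED}_{\mathrm{Fin}}=\{A\subseteq\Delta:\exists m\ \forall n\ |\{k:(n,k)\in A\}|<m\}$, an ideal on $\Delta$. For ideals $\mathcal I$ on $X$ and $\mathcal K$ on $Y$, $\mathcal I\le_{KB}\mathcal K$ ($\mathcal I\le_P\mathcal K$) means that there is a finite-to-one (one-to-one, respectively) function $f:Y\to X$ with $f^{-1}[B]\in\mathcal K$ for all $B\in\mathcal I$. $\mathcal J$ is a $P^+(\mathcal J)$-ideal if for each decreasing sequence $A_0\supseteq A_1\supseteq\dots$ of sets from $\mathcal J^+$ there is $B\in\mathcal J^+$ with $B\setminus A_n\in\mathcal J$ for all $n$. For $A\in\mathcal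 J^+$, $\mathcal J\restriction A=\{B\cap A:B\in\mathcal J\}$ (an ideal on $A$); $\mathcal J$ is $\le_{KB}$-homogeneous if $\mathcal J\restriction A\le_{KB}\mathcal J$ and $\mathcal J\le_{KB}\mathcal J\restriction A$ for every $A\in\mathcal J^+$. Ultrafilters on $\omega$ contain all cofinite sets; $\mathcal U^*=\{\omega\setminus A:A\in\mathcal U\}$. $\mathcal U$ is a weak $\mathcal J$-ultrafilter ($\mathcal J$-point) if $\mathcal J\not\le_{KB}\mathcal U^*$ ($\mathcal J\not\le_P\mathcal U^*$, respectively). $\mathcal U$ is a Q-point if for each partition $\{A_n:n\in\omega\}$ of $\omega$ into finite sets there is $A\in\mathcal U$ with $|A\cap A_n|=1$ for each $n$. *)

theory Defs
  imports "HOL-Analysis.Analysis"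
begin

unbundle cardinal_syntax

section \<open>Ideals\<close>

definition ideal_on :: "'a set \<Rightarrow> 'a set set \<Rightarrow> bool" where
  "ideal_on X J \<longleftrightarrow>
     J \<subseteq> Pow X \<and>
     (\<forall>A\<in>J. \<forall>B\<in>J. A \<union> B \<in> J) \<and>
     (\<forall>A\<in>J. \<forall>B. B \<subseteq> A \<longrightarrow> B \<in> J) \<and>
     (\<forall>A. A \<subseteq> X \<and> finite A \<longrightarrow> A \<in> J) \<and>
     X \<notin> J"

definition positive_sets :: "'a set \<Rightarrow> 'a set set \<Rightarrow> 'a set set" where
  "positive_sets X J = Pow X - J"

definition restr_ideal :: "'a set set \<Rightarrow> 'a set \<Rightarrow> 'a set set" where
  "restr_ideal J A = {B \<inter> A | B. B \<in> J}"

definition ED_Fin_dom :: "(nat \<times> nat) set" where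
  "ED_Fin_dom = {(n, k). n \<ge> k}"

definition ED_Fin :: "(nat \<times> nat) set set" where
  "ED_Fin = {A. A \<subseteq> ED_Fin_dom \<and> (\<exists>m. \<forall>n. card {k. (n, k) \<in> A} < m)}"

text \<open>Only the values of the witness \<open>f\<close> on \<open>Y\<close> matter in both orders below.\<close>

definition KB_le :: "'a set \<Rightarrow> 'a set set \<Rightarrow> 'b set \<Rightarrow> 'b set set \<Rightarrow> bool" where
  "KB_le X I Y K \<longleftrightarrow>
     (\<exists>f. f \<in> Y \<rightarrow> X \<and> (\<forall>x\<in>X. finite (f -` {x} \<inter> Y)) \<and> (\<forall>B\<in>I. f -` B \<inter> Y \<in> K))"

definition P_le :: "'a set \<Rightarrow> 'a set set \<Rightarrow> 'b set \<Rightarrow> 'b set set \<Rightarrow> bool" where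
  "P_le X I Y K \<longleftrightarrow>
     (\<exists>f. f \<in> Y \<rightarrow> X \<and> inj_on f Y \<and> (\<forall>B\<in>I. f -` B \<inter> Y \<in> K))"

definition P_plus_ideal :: "'a set \<Rightarrow> 'a set set \<Rightarrow> bool" where
  "P_plus_ideal X J \<longleftrightarrow>
     (\<forall>A :: nat \<Rightarrow> 'a set. decseq A \<and> (\<forall>n. A n \<in> positive_sets X J) \<longrightarrow>
        (\<exists>B\<in>positive_sets X J. \<forall>n. B - A n \<in> J))"

definition KB_homogeneous :: "'a set \<Rightarrow> 'a set set \<Rightarrow> bool" where
  "KB_homogeneous X J \<longleftrightarrow>
     (\<forall>A\<in>positive_sets X J.
        KB_le A (restr_ideal J A) X J \<and> KB_le X J A (restr_ideal J A))"

text \<open>Subsets of \<open>\<omega>\<close> are identified with their characteristic functions in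
  the product space \<open>nat \<Rightarrow> bool\<close>, where \<open>bool\<close> is discrete.\<close>

definition F_sigma_family :: "nat set set \<Rightarrow> bool" where
  "F_sigma_family J \<longleftrightarrow> fsigma ((\<lambda>A n. n \<in> A) ` J)"

section \<open>Ultrafilters on the natural numbers\<close>

definition ultrafilter :: "nat set set \<Rightarrow> bool" where
  "ultrafilter U \<longleftrightarrow>
     {} \<notin> U \<and>
     (\<forall>A\<in>U. \<forall>B\<in>U. A \<inter> B \<in> U) \<and>
     (\<forall>A\<in>U. \<forall>B. A \<subseteq> B \<longrightarrow> B \<in> U) \<and>
     (\<forall>A. A \<in> U \<or> - A \<in> U) \<and>
     (\<forall>A. finite (- A) \<longrightarrow> A \<in> U)"

definition dual_ideal :: "nat set set \<Rightarrow> nat set set" where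
  "dual_ideal U = {- A | A. A \<in> U}"

definition weak_ultrafilter_for :: "nat set set \<Rightarrow> nat set set \<Rightarrow> bool" where
  "weak_ultrafilter_for J U \<longleftrightarrow> ultrafilter U \<and> \<not> KB_le UNIV J UNIV (dual_ideal U)"

definition point_for :: "nat set set \<Rightarrow> nat set set \<Rightarrow> bool" where
  "point_for J U \<longleftrightarrow> ultrafilter U \<and> \<not> P_le UNIV J UNIV (dual_ideal U)"

definition Q_point :: "nat set set \<Rightarrow> bool" where
  "Q_point U \<longleftrightarrow>
     ultrafilter U \<and>
     (\<forall>P :: nat set set. partition_on UNIV P \<and> (\<forall>B\<in>P. finite B) \<longrightarrow>
        (\<exists>A\<in>U. \<forall>B\<in>P. card (A \<inter> B) = 1))"

section \<open>Cardinals\<close>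

definition continuum :: "(nat \<Rightarrow> bool) rel" where
  "continuum = ctwo ^c natLeq"

definition CH :: bool where
  "CH \<longleftrightarrow> continuum =o cardSuc natLeq"

definition strong_fip :: "nat set set \<Rightarrow> bool" where
  "strong_fip F \<longleftrightarrow> (\<forall>G. G \<subseteq> F \<and> finite G \<longrightarrow> infinite (\<Inter>G))"

definition pseudointersection :: "nat set set \<Rightarrow> nat set \<Rightarrow> bool" where
  "pseudointersection F B \<longleftrightarrow> infinite B \<and> (\<forall>A\<in>F. finite (B - A))"

text \<open>The least cardinality of a family with the strong finite intersection property
  and no infinite pseudointersection; the choice is unique up to \<open>=o\<close>.\<close>

definition pseudointersection_number :: "nat set rel" where
  "pseudointersection_number =
     (let C = {|F| | F. strong_fip F \<and> (\<nexists>B. pseudointersection F B)}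
      in SOME r. r \<in> C \<and> (\<forall>s\<in>C. r \<le>o s))"

end

theory Submission
  imports Defs "HOL-Library.Nat_Bijection" "HOL-Library.Countable_Set_Type"
begin

text \<open>Write (a), (b), (c) for: \<open>ED_Fin\<close> is not Katetov-Blass below \<open>J\<close>; some Q-point is not a
  \<open>J\<close>-point; some Q-point is not a weak \<open>J\<close>-ultrafilter. Call a set positive if it is not in \<open>J\<close>.

  Two implications hold outright. One-to-one functions are finite-to-one, so (b) implies (c). A set
  that meets each fibre of a finite-to-one function \<open>\<omega> \<rightarrow> \<Delta> \<rightarrow> \<omega>\<close> (the second map being the first
  projection) in one point has an image in \<open>ED_Fin\<close>; hence \<open>ED_Fin\<close> is not Katetov-Blass below the
  dual ideal of a Q-point (\<open>Q_point_not_above_ED_Fin\<close>), and by transitivity (c) implies (a).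

  For (a) implies (b), a Q-point consisting of positive sets is constructed; the identity then
  witnesses that it is not a \<open>J\<close>-point. Two ingredients are needed. First, under (a) and
  homogeneity every positive set has, for each finite-to-one \<open>h\<close>, a positive subset on which \<open>h\<close> is
  injective (\<open>positive_selector\<close>). Second, fewer than continuum many sets whose finite
  intersections are positive have a positive lower bound modulo \<open>J\<close>. Under CH this concerns
  countable families and is what the \<open>P\<^sup>+\<close>-property provides; for an F-sigma ideal and
  \<open>\<pp> = \<cc>\<close> it follows by taking a pseudointersection of families of codes of finite
  sets (\<open>F_sigma_imp_small_families_bounded\<close>). A recursion of length continuum then gives a
  family of positive sets, linearly ordered by inclusion modulo \<open>J\<close>, that decides every subset of
  \<open>\<omega>\<close> and contains a selector for every finite-to-one function (\<open>positive_tower\<close>); the filter it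
  generates modulo \<open>J\<close> is the Q-point.\<close>

section \<open>Ideals and the Katetov-Blass order\<close>

lemma ideal_onD:
  assumes "ideal_on UNIV J"
  shows ideal_Un: "A \<in> J \<Longrightarrow> B \<in> J \<Longrightarrow> A \<union> B \<in> J"
    and ideal_subset: "A \<in> J \<Longrightarrow> B \<subseteq> A \<Longrightarrow> B \<in> J"
    and ideal_finite: "finite A \<Longrightarrow> A \<in> J"
    and ideal_UNIV: "UNIV \<notin> J"
  using assms unfolding ideal_on_def by auto

lemma ideal_finite_UN:
  assumes "ideal_on UNIV J" "finite I" "\<And>i. i \<in> I \<Longrightarrow> A i \<in> J"
  shows "(\<Union>i\<in>I. A i) \<in> J"
  using assms(2,3)
  by (induction I) (auto intro: ideal_Un[OF assms(1)] ideal_finite[OF assms(1)])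

lemma KB_le_trans:
  assumes "KB_le X I Y K" "KB_le Y K Z L"
  shows "KB_le X I Z L"
proof -
  from assms(1) obtain f where f: "f \<in> Y \<rightarrow> X" "\<And>x. x \<in> X \<Longrightarrow> finite (f -` {x} \<inter> Y)"
    "\<And>B. B \<in> I \<Longrightarrow> f -` B \<inter> Y \<in> K" unfolding KB_le_def by blast
  from assms(2) obtain g where g: "g \<in> Z \<rightarrow> Y" "\<And>y. y \<in> Y \<Longrightarrow> finite (g -` {y} \<inter> Z)"
    "\<And>B. B \<in> K \<Longrightarrow> g -` B \<inter> Z \<in> L" unfolding KB_le_def by blast
  have preimage: "(f \<circ> g) -` B \<inter> Z = g -` (f -` B \<inter> Y) \<inter> Z" for B
    using g(1) by auto
  have fibre: "(f \<circ> g) -` {x} \<inter> Z = (\<Union>y\<in>f -` {x} \<inter> Y. g -` {y} \<inter> Z)" for x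
    using g(1) by auto
  have "finite ((f \<circ> g) -` {x} \<inter> Z)" if "x \<in> X" for x
    unfolding fibre using f(2)[OF that] g(2) by (intro finite_UN_I) auto
  moreover have "f \<circ> g \<in> Z \<rightarrow> X" using f(1) g(1) by auto
  moreover have "(f \<circ> g) -` B \<inter> Z \<in> L" if "B \<in> I" for B
    unfolding preimage using f(3) g(3) that by blast
  ultimately show ?thesis unfolding KB_le_def by blast
qed

lemma P_le_imp_KB_le:
  assumes "P_le X I Y K"
  shows "KB_le X I Y K"
proof -
  from assms obtain f where f: "f \<in> Y \<rightarrow> X" "inj_on f Y" "\<forall>B\<in>I. f -` B \<inter> Y \<in> K"
    unfolding P_le_def by blast
  have "finite (f -` {x} \<inter> Y)" for x
    using f(2) by (intro finite_vimage_IntI) auto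
  with f(1,3) show ?thesis unfolding KB_le_def by blast
qed

section \<open>Q-points and the ideal of sets bounded on columns\<close>

lemma inj_on_imp_card_le_one:
  assumes "inj_on h A" "\<And>a b. a \<in> B \<Longrightarrow> b \<in> B \<Longrightarrow> h a = h b"
  shows "card (A \<inter> B) \<le> 1"
proof -
  have "\<And>a b. a \<in> A \<inter> B \<Longrightarrow> b \<in> A \<inter> B \<Longrightarrow> a = b"
    using assms by (auto dest: inj_onD)
  then show ?thesis by (cases "finite (A \<inter> B)") (auto simp: card_le_Suc0_iff_eq)
qed

text \<open>The definition of a Q-point, applied to the partition into the nonempty fibres of \<open>h\<close>.\<close>
lemma Q_point_selector:
  assumes "Q_point U" "\<And>n::nat. finite (h -` {n})"
  obtains A where "A \<in> U" "inj_on h A"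
proof -
  define P where "P = {h -` {n} | n. h -` {n} \<noteq> {}}"
  have "partition_on UNIV P"
    unfolding P_def partition_on_def disjoint_def by auto
  moreover have "\<forall>B\<in>P. finite B" using assms(2) unfolding P_def by auto
  ultimately obtain A where A: "A \<in> U" "\<forall>B\<in>P. card (A \<inter> B) = 1"
    using assms(1) unfolding Q_point_def by blast
  have "inj_on h A"
  proof (rule inj_onI)
    fix a b assume ab: "a \<in> A" "b \<in> A" "h a = h b"
    have "h -` {h a} \<in> P" unfolding P_def by auto
    then have "card (A \<inter> h -` {h a}) = 1" using A(2) by blast
    then obtain c where "A \<inter> h -` {h a} = {c}" by (auto simp: card_1_singleton_iff)
    moreover have "a \<in> A \<inter> h -` {h a}" "b \<in> A \<inter> h -` {h a}" using ab by auto
    ultimately show "a = b" by auto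
  qed
  with A(1) show thesis by (rule that)
qed

lemma Q_point_not_above_ED_Fin:
  assumes "Q_point U"
  shows "\<not> KB_le ED_Fin_dom ED_Fin UNIV (dual_ideal U)"
proof
  assume "KB_le ED_Fin_dom ED_Fin UNIV (dual_ideal U)"
  then obtain f where f: "f \<in> UNIV \<rightarrow> ED_Fin_dom" "\<And>x. x \<in> ED_Fin_dom \<Longrightarrow> finite (f -` {x})"
    "\<And>B. B \<in> ED_Fin \<Longrightarrow> f -` B \<in> dual_ideal U" unfolding KB_le_def by auto
  have "finite ((fst \<circ> f) -` {n})" for n
  proof -
    have "(fst \<circ> f) -` {n} \<subseteq> (\<Union>k\<le>n. f -` {(n, k)})"
    proof
      fix a assume "a \<in> (fst \<circ> f) -` {n}"
      then have "f a = (n, snd (f a))" by (simp add: prod_eq_iff)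
      moreover have "f a \<in> ED_Fin_dom" using f(1) by auto
      ultimately have "snd (f a) \<le> n" unfolding ED_Fin_dom_def by (metis mem_Collect_eq case_prod_conv)
      then show "a \<in> (\<Union>k\<le>n. f -` {(n, k)})" using \<open>f a = (n, snd (f a))\<close> by blast
    qed
    moreover have "finite (f -` {(n, k)})" if "k \<le> n" for k
      using f(2)[of "(n, k)"] that unfolding ED_Fin_dom_def by simp
    then have "finite (\<Union>k\<le>n. f -` {(n, k)})" by simp
    ultimately show ?thesis using finite_subset by blast
  qed
  then obtain A where A: "A \<in> U" "inj_on (fst \<circ> f) A"
    using Q_point_selector[OF assms] by blast
  have "card {k. (n, k) \<in> f ` A} < 2" for n
  proof -
    have unique: "k = l" if "(n, k) \<in> f ` A" "(n, l) \<in> f ` A" for k l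
    proof -
      from that obtain a b where ab: "a \<in> A" "f a = (n, k)" "b \<in> A" "f b = (n, l)" by (metis imageE)
      then have "a = b" using inj_onD[OF A(2), of a b] by simp
      then show "k = l" using ab by simp
    qed
    have "card {k. (n, k) \<in> f ` A} \<le> card {THE k. (n, k) \<in> f ` A}"
      using unique by (intro card_mono) (auto intro!: the_equality[symmetric])
    then show ?thesis by simp
  qed
  then have "f ` A \<in> ED_Fin" using f(1) unfolding ED_Fin_def by (auto simp: Pi_iff)
  then have "f -` f ` A \<in> dual_ideal U" by (rule f(3))
  then have "- (f -` f ` A) \<in> U" unfolding dual_ideal_def by auto
  with A(1) have "A \<inter> - (f -` f ` A) \<in> U" "{} \<notin> U"
    using assms unfolding Q_point_def ultrafilter_def by blast+
  moreover have "A \<inter> - (f -` f ` A) = {}" by auto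
  ultimately show False by simp
qed

text \<open>If no positive subset of \<open>A\<close> meets every block \<open>h -` {n}\<close> at most once, then the ideal
  contains all subsets of \<open>A\<close> with boundedly many points in each block; placing the \<open>n\<close>-th block
  into a sufficiently long column of \<open>\<Delta>\<close> then shows that \<open>ED_Fin\<close> is Katetov-Blass below
  the restriction of \<open>J\<close> to \<open>A\<close>.\<close>
lemma positive_selector:
  fixes h :: "nat \<Rightarrow> nat"
  assumes J: "ideal_on UNIV J" and fin: "\<And>n. finite (h -` {n})"
    and not_le: "\<not> KB_le ED_Fin_dom ED_Fin A (restr_ideal J A)"
  shows "\<exists>B\<subseteq>A. B \<notin> J \<and> inj_on h B"
proof (rule ccontr)
  assume "\<not> ?thesis"
  then have sel: "B \<in> J" if "B \<subseteq> A" "inj_on h B" for B using that by blast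
  have bounded: "B \<in> J" if "B \<subseteq> A" "\<And>n. card (B \<inter> h -` {n}) \<le> m" for B m
    using that
  proof (induction m arbitrary: B)
    case 0
    then have "B \<inter> h -` {n} = {}" for n using fin by (metis card_0_eq finite_Int le_zero_eq)
    then have "B = {}" by auto
    then show ?case using ideal_finite[OF J] by simp
  next
    case (Suc m)
    define S where "S = {a\<in>B. a = Min (B \<inter> h -` {h a})}"
    have "inj_on h S" unfolding S_def by (rule inj_onI) (metis (mono_tags, lifting) mem_Collect_eq)
    then have "S \<in> J" using Suc.prems(1) by (intro sel) (auto simp: S_def)
    moreover have "B - S \<in> J"
    proof (rule Suc.IH)
      show "B - S \<subseteq> A" using Suc.prems(1) by auto
      fix n
      show "card ((B - S) \<inter> h -` {n}) \<le> m"
      proof (cases "B \<inter> h -` {n} = {}")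
        case True
        then have "(B - S) \<inter> h -` {n} = {}" by auto
        then show ?thesis by (metis card.empty zero_le)
      next
        case False
        let ?a = "Min (B \<inter> h -` {n})"
        have a: "?a \<in> B \<inter> h -` {n}" using False fin by (intro Min_in) auto
        then have "?a \<in> S" unfolding S_def by auto
        then have "(B - S) \<inter> h -` {n} \<subseteq> B \<inter> h -` {n} - {?a}" by auto
        then have "card ((B - S) \<inter> h -` {n}) \<le> card (B \<inter> h -` {n} - {?a})"
          using fin by (intro card_mono) auto
        also have "\<dots> \<le> m" using a Suc.prems(2)[of n] by simp
        finally show ?thesis .
      qed
    qed
    ultimately have "S \<union> (B - S) \<in> J" by (rule ideal_Un[OF J])
    then show ?case by (rule ideal_subset[OF J]) auto
  qed
  \<comment> \<open>Distinct blocks go to distinct columns, each at least as long as the maximum of its block.\<close>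
  define g where "g n = prod_encode (n, Max (h -` {n}))" for n
  define f where "f a = (g (h a), a)" for a
  have "a \<le> g (h a)" for a
  proof -
    have "a \<le> Max (h -` {h a})" using fin by (intro Max_ge) auto
    also have "\<dots> \<le> g (h a)" unfolding g_def by (rule le_prod_encode_2)
    finally show ?thesis .
  qed
  then have "f \<in> A \<rightarrow> ED_Fin_dom" unfolding f_def ED_Fin_dom_def by auto
  moreover have "finite (f -` {x} \<inter> A)" for x
    by (rule finite_subset[of _ "{snd x}"]) (auto simp: f_def)
  moreover have "f -` B \<inter> A \<in> restr_ideal J A" if "B \<in> ED_Fin" for B
  proof -
    from that obtain m where B: "B \<subseteq> ED_Fin_dom" "\<And>n. card {k. (n, k) \<in> B} < m"
      unfolding ED_Fin_def by auto
    have "f -` B \<inter> A \<in> J"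
    proof (rule bounded)
      fix n
      have "{k. (g n, k) \<in> B} \<subseteq> {..g n}" using B(1) unfolding ED_Fin_dom_def by auto
      then have "finite {k. (g n, k) \<in> B}" by (rule finite_subset) simp
      then have "card ((f -` B \<inter> A) \<inter> h -` {n}) \<le> card {k. (g n, k) \<in> B}"
        by (rule card_mono) (auto simp: f_def)
      also have "\<dots> \<le> m" using B(2) by (simp add: less_imp_le)
      finally show "card ((f -` B \<inter> A) \<inter> h -` {n}) \<le> m" .
    qed simp
    then show ?thesis unfolding restr_ideal_def by auto
  qed
  ultimately show False using not_le unfolding KB_le_def by blast
qed

section \<open>Lower bounds of small families of positive sets\<close>

text \<open>Every family of fewer than continuum many sets whose finite intersections are positive
  has a positive lower bound modulo \<open>J\<close>.\<close>
definition small_families_bounded :: "nat set set \<Rightarrow> bool" where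
  "small_families_bounded J \<longleftrightarrow>
     (\<forall>F :: nat set set. |F| <o continuum \<and> (\<forall>G\<subseteq>F. finite G \<longrightarrow> \<Inter>G \<notin> J) \<longrightarrow>
        (\<exists>B. B \<notin> J \<and> (\<forall>A\<in>F. B - A \<in> J)))"

lemma CH_imp_small_families_bounded:
  assumes CH and J: "ideal_on UNIV J" and P: "P_plus_ideal UNIV J"
  shows "small_families_bounded J"
  unfolding small_families_bounded_def
proof (intro allI impI, elim conjE)
  fix F :: "nat set set"
  assume F: "|F| <o continuum" and fip: "\<forall>G\<subseteq>F. finite G \<longrightarrow> \<Inter>G \<notin> J"
  have "|F| <o cardSuc natLeq"
    using F \<open>CH\<close> unfolding CH_def by (rule ordLess_ordIso_trans)
  then have "|F| \<le>o natLeq"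
    using cardSuc_ordLeq_ordLess[OF natLeq_Card_order card_of_Card_order] by blast
  then have "countable F" by (simp add: countable_card_le_natLeq)
  show "\<exists>B. B \<notin> J \<and> (\<forall>A\<in>F. B - A \<in> J)"
  proof (cases "F = {}")
    case True
    then show ?thesis using ideal_UNIV[OF J] by auto
  next
    case False
    \<comment> \<open>The \<open>P\<^sup>+\<close>-property speaks of decreasing sequences, hence the finite intersections.\<close>
    define A where "A n = \<Inter>(from_nat_into F ` {..n})" for n
    have "decseq A" unfolding A_def decseq_def by (auto intro!: INF_superset_mono)
    moreover have "A n \<in> positive_sets UNIV J" for n
    proof -
      have "from_nat_into F ` {..n} \<subseteq> F" using False by (auto intro: from_nat_into)
      then show ?thesis using fip unfolding positive_sets_def A_def by auto
    qed
    ultimately obtain B where B: "B \<in> positive_sets UNIV J" "\<And>n. B - A n \<in> J"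
      using P unfolding P_plus_ideal_def by blast
    have "B - C \<in> J" if C: "C \<in> F" for C
    proof -
      obtain n where "from_nat_into F n = C"
        using from_nat_into_surj[OF \<open>countable F\<close> C] by blast
      then have "A n \<subseteq> C" unfolding A_def by auto
      then show ?thesis by (intro ideal_subset[OF J B(2)[of n]]) auto
    qed
    then show ?thesis using B(1) unfolding positive_sets_def by auto
  qed
qed

text \<open>A family without pseudointersection also shows that the set of cardinals in the definition
  of \<open>pseudointersection_number\<close> is nonempty, so that the choice made there is a genuine minimum.\<close>
lemma pseudointersection_exists:
  assumes "|F| <o pseudointersection_number" "strong_fip F"
  obtains B where "pseudointersection F B"
proof (rule ccontr)
  assume no: "\<not> thesis"
  let ?C = "{|F| | F. strong_fip F \<and> (\<nexists>B. pseudointersection F B)}"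
  have F: "|F| \<in> ?C" using assms(2) no that by blast
  have "\<forall>r\<in>?C. Card_order r" by (auto simp: card_of_Card_order)
  then have "\<exists>r\<in>?C. \<forall>s\<in>?C. r \<le>o s" using F by (intro exists_minim_Card_order) blast+
  then have "\<exists>r. r \<in> ?C \<and> (\<forall>s\<in>?C. r \<le>o s)" by blast
  from someI_ex[OF this] have "pseudointersection_number \<le>o |F|"
    using F unfolding pseudointersection_number_def Let_def by blast
  then show False using assms(1) not_ordLess_ordLeq by blast
qed

text \<open>Compactness of \<open>2\<^sup>\<omega>\<close>: if each finite subset of \<open>X\<close> is included in a member of the closed
  family \<open>C\<close>, then so is \<open>X\<close>.\<close>
lemma closed_family_compactness:
  fixes C :: "(nat \<Rightarrow> bool) set"
  assumes "closed C" "\<And>s. finite s \<Longrightarrow> s \<subseteq> X \<Longrightarrow> \<exists>Y\<in>C. \<forall>i\<in>s. Y i"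
  shows "\<exists>Y\<in>C. \<forall>i\<in>X. Y i"
proof -
  have "compact_space (product_topology (\<lambda>i::nat. euclidean :: bool topology) UNIV)"
    unfolding compact_space_product_topology
    by (auto simp: compact_space_def finite_imp_compact)
  then have "compact (UNIV :: (nat \<Rightarrow> bool) set)"
    by (simp add: euclidean_product_topology compact_space_def)
  then have "compact C" using assms(1) closed_Int_compact[of C UNIV] by simp
  moreover have "closed {Y :: nat \<Rightarrow> bool. Y i}" for i
  proof -
    have "closed ((\<lambda>Y :: nat \<Rightarrow> bool. Y i) -` {True})"
      by (intro closed_vimage continuous_on_product_coordinates) auto
    then show ?thesis by (simp add: vimage_def)
  qed
  moreover have "C \<inter> (\<Inter>i\<in>s. {Y. Y i}) \<noteq> {}" if "finite s" "s \<subseteq> X" for s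
    using assms(2)[OF that] by auto
  ultimately have "C \<inter> (\<Inter>i\<in>X. {Y. Y i}) \<noteq> {}"
    by (rule compact_imp_fip_image[where f = "\<lambda>i. {Y. Y i}"])
  then show ?thesis by auto
qed

text \<open>Write \<open>J\<close> as the union of closed families \<open>C n\<close>, and call a finite set \<open>s\<close> \<open>n\<close>-large if no
  member of \<open>C 0, \<dots>, C n\<close> includes it. By compactness a positive set has \<open>n\<close>-large subsets for
  every \<open>n\<close>, and a set with \<open>n\<close>-large subsets for unboundedly many \<open>n\<close> is positive. The required
  lower bound is therefore read off from a pseudointersection of the sets of all (codes of) pairs
  \<open>(n, s)\<close> with \<open>s\<close> an \<open>n\<close>-large finite subset of \<open>A\<close>, for \<open>A \<in> F\<close>; the sets
  \<open>high k\<close> of pairs with \<open>n \<ge> k\<close> are added so that \<open>n\<close> is unbounded on the pseudointersection.\<close>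
lemma F_sigma_imp_small_families_bounded:
  assumes J: "ideal_on UNIV J" and Fs: "F_sigma_family J"
    and pc: "pseudointersection_number =o continuum"
  shows "small_families_bounded J"
  unfolding small_families_bounded_def
proof (intro allI impI, elim conjE)
  fix F :: "nat set set"
  assume F: "|F| <o continuum" and fip: "\<forall>G\<subseteq>F. finite G \<longrightarrow> \<Inter>G \<notin> J"
  from Fs obtain C :: "nat \<Rightarrow> (nat \<Rightarrow> bool) set"
    where C: "\<And>n. closed (C n)" "(\<lambda>A n. n \<in> A) ` J = (\<Union>n. C n)"
    unfolding F_sigma_family_def fsigma.simps by blast
  have in_J: "A \<in> J \<longleftrightarrow> (\<exists>n. (\<lambda>i. i \<in> A) \<in> C n)" for A
  proof -
    have "A \<in> J \<longleftrightarrow> (\<lambda>i. i \<in> A) \<in> (\<lambda>A n. n \<in> A) ` J"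
      by (auto simp: fun_eq_iff image_iff) (metis Collect_mem_eq Collect_cong)
    then show ?thesis using C(2) by auto
  qed
  define large where
    "large n s \<longleftrightarrow> finite s \<and> (\<forall>m\<le>n. \<not> (\<exists>Y\<in>C m. \<forall>i\<in>s. Y i))" for n :: nat and s :: "nat set"
  define code where "code n s = prod_encode (n, set_encode s)" for n s
  define pairs where "pairs A = {code n s | n s. large n s \<and> s \<subseteq> A}" for A
  define high where "high k = {code n s | n s. large n s \<and> k \<le> n}" for k
  have code_eq: "n = m \<and> s = t" if "code n s = code m t" "finite s" "finite t" for n m s t
    using that set_encode_inverse unfolding code_def by (metis prod.inject prod_encode_eq)
  have large_subset: "\<exists>s. large n s \<and> s \<subseteq> A" if "A \<notin> J" for A n
  proof -
    have "\<exists>s. finite s \<and> s \<subseteq> A \<and> \<not> (\<exists>Y\<in>C m. \<forall>i\<in>s. Y i)" for m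
    proof (rule ccontr)
      assume "\<not> ?thesis"
      then obtain Y where Y: "Y \<in> C m" "\<forall>i\<in>A. Y i"
        using closed_family_compactness[OF C(1)[of m], of A] by blast
      then have "{i. Y i} \<in> J" unfolding in_J by auto
      then have "A \<in> J" by (rule ideal_subset[OF J]) (use Y in auto)
      with that show False by simp
    qed
    then obtain s where s: "\<And>m. finite (s m) \<and> s m \<subseteq> A \<and> \<not> (\<exists>Y\<in>C m. \<forall>i\<in>s m. Y i)" by metis
    have "large n (\<Union>m\<le>n. s m)" unfolding large_def using s by auto (metis atMost_iff)
    then show ?thesis using s by blast
  qed
  have "strong_fip (pairs ` F \<union> range high)"
    unfolding strong_fip_def
  proof (intro allI impI, elim conjE)
    fix G assume G: "G \<subseteq> pairs ` F \<union> range high" "finite G"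
    obtain G1 where G1: "G1 \<subseteq> F" "finite G1" "G \<inter> pairs ` F = pairs ` G1"
      using finite_subset_image[of "G \<inter> pairs ` F" pairs F] G(2) by auto
    obtain K where K: "finite K" "G \<inter> range high = high ` K"
      using finite_subset_image[of "G \<inter> range high" high UNIV] G(2) by auto
    obtain k where k: "\<And>i. i \<in> K \<Longrightarrow> i \<le> k" using K(1) finite_nat_set_iff_bounded_le by auto
    have "\<Inter>G1 \<notin> J" using fip G1 by blast
    then obtain s where s: "\<And>n. large n (s n) \<and> s n \<subseteq> \<Inter>G1" using large_subset by metis
    have "code n (s n) \<in> \<Inter>G" if "k \<le> n" for n
    proof
      fix D assume "D \<in> G"
      then have "D \<in> G \<inter> pairs ` F \<or> D \<in> G \<inter> range high" using G(1) by blast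
      then have "D \<in> pairs ` G1 \<or> D \<in> high ` K" unfolding G1(3) K(2) .
      then show "code n (s n) \<in> D"
      proof
        assume "D \<in> pairs ` G1"
        then obtain A where "A \<in> G1" "D = pairs A" by (rule imageE)
        then show ?thesis using s[of n] unfolding pairs_def by blast
      next
        assume "D \<in> high ` K"
        then obtain i where "i \<in> K" "D = high i" by (rule imageE)
        moreover from this have "i \<le> n" using k[of i] that by simp
        ultimately show ?thesis using s[of n] unfolding high_def by blast
      qed
    qed
    then have "(\<lambda>n. code n (s n)) ` {k..} \<subseteq> \<Inter>G" by auto
    moreover have "inj_on (\<lambda>n. code n (s n)) {k..}"
      unfolding code_def by (rule inj_onI) simp
    then have "infinite ((\<lambda>n. code n (s n)) ` {k..})"
      using infinite_Ici finite_imageD by blast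
    ultimately show "infinite (\<Inter>G)" using finite_subset by blast
  qed
  moreover have "|pairs ` F \<union> range high| <o pseudointersection_number"
  proof -
    have "natLeq <o continuum"
      unfolding continuum_def by (rule ordLess_ctwo_cexp[OF natLeq_Card_order])
    have "countable (range high)" by simp
    then have "|range high| \<le>o natLeq" by (rule countable_card_le_natLeq[THEN iffD1])
    then have "|range high| <o continuum" using \<open>natLeq <o continuum\<close> by (rule ordLeq_ordLess_trans)
    moreover have "|pairs ` F| <o continuum" using card_of_image F by (rule ordLeq_ordLess_trans)
    moreover have "Cinfinite continuum"
      unfolding continuum_def
      by (rule Cinfinite_cexp[OF ordLeq_refl[OF Card_order_ctwo] natLeq_Cinfinite])
    ultimately have "|pairs ` F \<union> range high| <o continuum"
      unfolding cinfinite_def by (intro card_of_Un_ordLess_infinite_Field) simp_all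
    then show ?thesis using ordIso_symmetric[OF pc] by (rule ordLess_ordIso_trans)
  qed
  ultimately obtain Y where Y: "pseudointersection (pairs ` F \<union> range high) Y"
    using pseudointersection_exists by blast
  define B where "B = \<Union>{s. \<exists>n. large n s \<and> code n s \<in> Y}"
  have "B \<notin> J"
  proof
    assume "B \<in> J"
    then obtain m where m: "(\<lambda>i. i \<in> B) \<in> C m" unfolding in_J by blast
    have "infinite Y" "finite (Y - high m)" using Y unfolding pseudointersection_def by blast+
    then have "Y \<inter> high m \<noteq> {}" by (metis Diff_triv)
    then obtain n s where "large n s" "m \<le> n" "code n s \<in> Y" unfolding high_def by blast
    moreover from this have "\<forall>i\<in>s. i \<in> B" unfolding B_def by blast
    ultimately show False using m unfolding large_def by blast
  qed
  moreover have "B - A \<in> J" if "A \<in> F" for A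
  proof (rule ideal_finite[OF J])
    let ?S = "{s. \<exists>n. large n s \<and> code n s \<in> Y - pairs A}"
    have "finite (Y - pairs A)" using Y that unfolding pseudointersection_def by auto
    moreover have "?S \<subseteq> (\<lambda>c. set_decode (snd (prod_decode c))) ` (Y - pairs A)"
    proof
      fix s assume "s \<in> ?S"
      then obtain n where "large n s" "code n s \<in> Y - pairs A" by blast
      moreover from this have "set_decode (snd (prod_decode (code n s))) = s"
        unfolding code_def large_def by simp
      ultimately show "s \<in> (\<lambda>c. set_decode (snd (prod_decode c))) ` (Y - pairs A)"
        by (metis imageI)
    qed
    ultimately have "finite ?S" by (meson finite_imageI finite_subset)
    then have "finite (\<Union>?S)" by (rule finite_Union) (auto simp: large_def)
    moreover have "B - A \<subseteq> \<Union>?S"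
    proof
      fix i assume i: "i \<in> B - A"
      then obtain n s where s: "large n s" "code n s \<in> Y" "i \<in> s" unfolding B_def by blast
      have "code n s \<notin> pairs A"
      proof
        assume "code n s \<in> pairs A"
        then obtain m t where t: "code n s = code m t" "large m t" "t \<subseteq> A"
          unfolding pairs_def by blast
        then have "s = t" using code_eq[OF t(1)] s(1) unfolding large_def by blast
        then show False using s(3) t(3) i by blast
      qed
      then show "i \<in> \<Union>?S" using s by blast
    qed
    ultimately show "finite (B - A)" by (rule finite_subset[rotated])
  qed
  ultimately show "\<exists>B. B \<notin> J \<and> (\<forall>A\<in>F. B - A \<in> J)" by blast
qed

section \<open>Construction of a Q-point of positive sets\<close>

lemma card_of_sets_of_nat: "|UNIV :: nat set set| =o continuum"
  using card_of_Pow_Func[of "UNIV :: nat set"]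
  unfolding continuum_def cexp_def ctwo_def by (simp add: Field_natLeq Field_card_of)

text \<open>The sets \<open>A x\<close> are defined by recursion along a well-order of type continuum of all sets of
  naturals. Each \<open>x\<close> serves twice: as a set to be decided, and as the code of the graph of a
  function \<open>h\<close> that has to be injective on \<open>A x\<close> if it is finite-to-one.\<close>
lemma positive_tower:
  fixes J :: "nat set set"
  assumes J: "ideal_on UNIV J" and bounded: "small_families_bounded J"
    and selector: "\<And>A h. A \<notin> J \<Longrightarrow> (\<And>n::nat. finite (h -` {n})) \<Longrightarrow>
      \<exists>B\<subseteq>A. B \<notin> J \<and> inj_on h B"
  obtains A :: "nat set \<Rightarrow> nat set" where "\<And>x. A x \<notin> J"
    "\<And>x. A x \<subseteq> x \<or> A x \<subseteq> - x"
    "\<And>h. (\<And>n::nat. finite (h -` {n})) \<Longrightarrow> \<exists>x. inj_on h (A x)"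
    "\<And>x y. A x - A y \<in> J \<or> A y - A x \<in> J"
proof -
  define r where "r = |UNIV :: nat set set|"
  have co: "Card_order r" unfolding r_def by (rule card_of_Card_order)
  have wo: "Well_order r" unfolding r_def by (rule card_of_Well_order)
  have field: "Field r = UNIV" unfolding r_def by (rule Field_card_of)
  define R where "R = r - Id"
  have wf: "wf R" using wo unfolding well_order_on_def R_def by blast
  have total: "(x, y) \<in> R \<or> x = y \<or> (y, x) \<in> R" for x y
    using wo field unfolding R_def well_order_on_def linear_order_on_def total_on_def by auto
  have trans_R: "(x, z) \<in> R" if "(x, y) \<in> R" "(y, z) \<in> R" for x y z
  proof -
    have "trans r" "antisym r"
      using wo by (auto simp: well_order_on_def linear_order_on_def partial_order_on_def
          preorder_on_def)
    then show ?thesis using that unfolding R_def by (auto dest: transD antisymD)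
  qed
  define graph where "graph h = prod_encode ` {(a, h a) | a. True}" for h :: "nat \<Rightarrow> nat"
  have graph_inj: "h = h'" if "graph h = graph h'" for h h'
  proof
    fix a
    have "{(a, h a) | a. True} = {(a, h' a) | a. True}"
      using that inj_prod_encode unfolding graph_def by (simp add: inj_image_eq_iff)
    then show "h a = h' a" by blast
  qed
  define P where "P A x b \<longleftrightarrow> b \<notin> J \<and> (\<forall>y. (y, x) \<in> R \<longrightarrow> b - A y \<in> J) \<and>
      (b \<subseteq> x \<or> b \<subseteq> - x) \<and>
      (\<forall>h. (\<forall>n. finite (h -` {n})) \<and> x = graph h \<longrightarrow> inj_on h b)"
    for A :: "nat set \<Rightarrow> nat set" and x b
  have "\<exists>A. \<forall>x. P A x (A x)"
  proof (rule dependent_wf_choice[OF wf])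
    show "P f x b = P g x b" if "\<And>z. (z, x) \<in> R \<Longrightarrow> f z = g z" for f g x b
      using that unfolding P_def by auto
  next
    fix x f assume prev: "\<And>y. (y, x) \<in> R \<Longrightarrow> P f y (f y)"
    define F where "F = f ` {y. (y, x) \<in> R}"
    have fip: "\<Inter>G \<notin> J" if G: "G \<subseteq> F" "finite G" for G
    proof -
      obtain I where I: "I \<subseteq> {y. (y, x) \<in> R}" "finite I" "G = f ` I"
        using finite_subset_image[OF G(2)] G(1) unfolding F_def by blast
      show ?thesis
      proof (cases "I = {}")
        case True
        then show ?thesis using I(3) ideal_UNIV[OF J] by simp
      next
        case False
        \<comment> \<open>The last index in \<open>I\<close> carries the least set modulo \<open>J\<close>.\<close>
        have "wf (R\<inverse> \<inter> I \<times> I)"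
        proof (rule finite_acyclic_wf)
          show "finite (R\<inverse> \<inter> I \<times> I)" using I(2) by auto
          have "acyclic (R\<inverse>)" using wf by (simp add: wf_acyclic)
          then show "acyclic (R\<inverse> \<inter> I \<times> I)" by (rule acyclic_subset) auto
        qed
        from wfE_min'[OF this False]
        obtain y where min: "y \<in> I" "\<And>z. (z, y) \<in> R\<inverse> \<inter> I \<times> I \<Longrightarrow> z \<notin> I" by metis
        have y: "(y, z) \<notin> R" if "z \<in> I" for z using min(2)[of z] min(1) that by auto
        have py: "P f y (f y)" using I(1) min(1) prev by blast
        have "f y - f z \<in> J" if "z \<in> I" for z
          using total[of z y] y[OF that] py ideal_finite[OF J] unfolding P_def by auto
        then have "(\<Union>z\<in>I. f y - f z) \<in> J" by (rule ideal_finite_UN[OF J I(2)])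
        then have "f y - \<Inter>G \<in> J" unfolding I(3) by (rule ideal_subset[OF J]) auto
        moreover have "f y \<subseteq> (f y - \<Inter>G) \<union> \<Inter>G" by auto
        moreover have "f y \<notin> J" using py unfolding P_def by blast
        ultimately show ?thesis
          using ideal_Un[OF J, of "f y - \<Inter>G" "\<Inter>G"] ideal_subset[OF J] by metis
      qed
    qed
    have "{y. (y, x) \<in> R} = underS r x" unfolding R_def underS_def by auto
    then have "|{y. (y, x) \<in> R}| <o r" using card_of_underS[OF co] field by simp
    then have "|{y. (y, x) \<in> R}| <o continuum"
      using card_of_sets_of_nat unfolding r_def by (rule ordLess_ordIso_trans)
    then have "|F| <o continuum"
      unfolding F_def by (rule ordLeq_ordLess_trans[OF card_of_image])
    then obtain B where B: "B \<notin> J" "\<forall>A\<in>F. B - A \<in> J"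
      using bounded fip unfolding small_families_bounded_def by blast
    have "(B \<inter> x) \<union> (B - x) = B" by auto
    then have "B \<inter> x \<notin> J \<or> B - x \<notin> J" using B(1) ideal_Un[OF J] by metis
    then have "\<exists>D. D \<subseteq> B \<and> D \<notin> J \<and> (D \<subseteq> x \<or> D \<subseteq> - x)"
    proof
      assume "B \<inter> x \<notin> J"
      then show ?thesis by (intro exI[of _ "B \<inter> x"]) auto
    next
      assume "B - x \<notin> J"
      then show ?thesis by (intro exI[of _ "B - x"]) auto
    qed
    then obtain D where D: "D \<subseteq> B" "D \<notin> J" "D \<subseteq> x \<or> D \<subseteq> - x" by blast
    obtain E where E: "E \<subseteq> D" "E \<notin> J"
      "\<And>h. (\<forall>n. finite (h -` {n})) \<Longrightarrow> x = graph h \<Longrightarrow> inj_on h E"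
    proof (cases "\<exists>h. (\<forall>n. finite (h -` {n})) \<and> x = graph h")
      case True
      then obtain h where h: "\<And>n. finite (h -` {n})" "x = graph h" by blast
      obtain E where "E \<subseteq> D" "E \<notin> J" "inj_on h E" using selector[OF D(2) h(1)] by blast
      then show thesis using that graph_inj h(2) by metis
    next
      case False
      then show thesis using that[of D] D(2) by blast
    qed
    have "E - f y \<in> J" if "(y, x) \<in> R" for y
    proof -
      have "B - f y \<in> J" using B(2) that unfolding F_def by blast
      then show ?thesis by (rule ideal_subset[OF J]) (use E D in auto)
    qed
    then show "\<exists>b. P f x b" using E D(3) unfolding P_def by (intro exI[of _ E]) blast
  qed
  then obtain A where A: "\<And>x. P A x (A x)" by blast
  show thesis
  proof
    show "A x \<notin> J" "A x \<subseteq> x \<or> A x \<subseteq> - x" for x using A[of x] unfolding P_def by auto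
    show "\<exists>x. inj_on h (A x)" if "\<And>n. finite (h -` {n})" for h :: "nat \<Rightarrow> nat"
      using A[of "graph h"] that unfolding P_def by blast
    show "A x - A y \<in> J \<or> A y - A x \<in> J" for x y
      using total[of x y] A[of x] A[of y] ideal_finite[OF J] unfolding P_def by auto
  qed
qed

text \<open>The filter generated modulo \<open>J\<close> by a tower as above is the required ultrafilter.\<close>
lemma Q_point_of_positive_sets:
  assumes J: "ideal_on UNIV J" and bounded: "small_families_bounded J"
    and selector: "\<And>A h. A \<notin> J \<Longrightarrow> (\<And>n::nat. finite (h -` {n})) \<Longrightarrow>
      \<exists>B\<subseteq>A. B \<notin> J \<and> inj_on h B"
  obtains U where "Q_point U" "U \<inter> J = {}"
proof -
  obtain A :: "nat set \<Rightarrow> nat set" where A: "\<And>x. A x \<notin> J"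
    "\<And>x. A x \<subseteq> x \<or> A x \<subseteq> - x"
    "\<And>h. (\<And>n::nat. finite (h -` {n})) \<Longrightarrow> \<exists>x. inj_on h (A x)"
    "\<And>x y. A x - A y \<in> J \<or> A y - A x \<in> J"
    using positive_tower[OF assms] by blast
  define U where "U = {X. \<exists>x. A x - X \<in> J}"
  have upward: "Y \<in> U" if "X \<in> U" "X \<subseteq> Y" for X Y
  proof -
    from that(1) obtain x where "A x - X \<in> J" unfolding U_def by blast
    then have "A x - Y \<in> J" by (rule ideal_subset[OF J]) (use that(2) in auto)
    then show ?thesis unfolding U_def by blast
  qed
  have positive: "X \<notin> J" if "X \<in> U" for X
  proof
    assume "X \<in> J"
    from that obtain x where x: "A x - X \<in> J" unfolding U_def by blast
    have "A x \<in> J" by (rule ideal_subset[OF J ideal_Un[OF J x \<open>X \<in> J\<close>]]) auto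
    then show False using A(1) by blast
  qed
  have inter: "X \<inter> Y \<in> U" if XY: "X \<in> U" "Y \<in> U" for X Y
  proof -
    have *: "X \<inter> Y \<in> U" if "A x - X \<in> J" "A y - Y \<in> J" "A x - A y \<in> J" for x y X Y
    proof -
      have "A x - (X \<inter> Y) \<in> J"
        by (rule ideal_subset[OF J ideal_Un[OF J ideal_Un[OF J that(1,2)] that(3)]]) auto
      then show ?thesis unfolding U_def by blast
    qed
    from XY obtain x y where "A x - X \<in> J" "A y - Y \<in> J" unfolding U_def by blast
    then show ?thesis using A(4)[of x y] *[of x X y Y] *[of y Y x X] by (auto simp: Int_commute)
  qed
  have decide: "X \<in> U \<or> - X \<in> U" for X
  proof -
    have "A X - X = {} \<or> A X - (- X) = {}" using A(2)[of X] by auto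
    then show ?thesis using ideal_finite[OF J] unfolding U_def by (metis finite.emptyI mem_Collect_eq)
  qed
  have "{} \<notin> U" using positive ideal_finite[OF J] by blast
  moreover have "X \<in> U" if "finite (- X)" for X
    using decide[of X] positive[of "- X"] ideal_finite[OF J that] by blast
  ultimately have ultra: "ultrafilter U"
    unfolding ultrafilter_def using upward inter decide by blast
  have "\<exists>S\<in>U. \<forall>B\<in>P. card (S \<inter> B) = 1"
    if P: "partition_on UNIV P" "\<forall>B\<in>P. finite B" for P
  proof -
    \<comment> \<open>The partition is turned into a finite-to-one function by naming each block by its minimum.\<close>
    define block where "block a = (THE B. B \<in> P \<and> a \<in> B)" for a
    have block_eq: "block a = B" if "B \<in> P" "a \<in> B" for a B
      unfolding block_def using P(1) that
      by (intro the_equality) (auto simp: partition_on_def disjoint_def)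
    have block_in: "block a \<in> P \<and> a \<in> block a" for a
    proof -
      obtain B where "B \<in> P" "a \<in> B" using P(1) unfolding partition_on_def by blast
      then show ?thesis using block_eq by metis
    qed
    have Min_block: "Min (block a) \<in> block a" for a
      using block_in[of a] P(2) by (intro Min_in) auto
    define h where "h a = Min (block a)" for a
    have "finite (h -` {n})" for n
    proof (rule finite_subset)
      show "h -` {n} \<subseteq> block n"
      proof
        fix a assume "a \<in> h -` {n}"
        then have "n \<in> block a" using Min_block[of a] unfolding h_def by auto
        then have "block n = block a" using block_in block_eq by blast
        then show "a \<in> block n" using block_in by blast
      qed
      show "finite (block n)" using block_in P(2) by blast
    qed
    then obtain x where x: "inj_on h (A x)" using A(3) by blast
    \<comment> \<open>Blocks missed by the partial selector contribute their minimum.\<close>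
    define S where "S = A x \<union> {Min B | B. B \<in> P \<and> A x \<inter> B = {}}"
    have "card (S \<inter> B) = 1" if B: "B \<in> P" for B
    proof (cases "A x \<inter> B = {}")
      case True
      have "Min B \<in> B" "B \<noteq> {}"
        using B P by (auto simp: partition_on_def intro!: Min_in)
      have "S \<inter> B = {Min B}"
      proof
        show "{Min B} \<subseteq> S \<inter> B" using \<open>Min B \<in> B\<close> B True unfolding S_def by auto
        show "S \<inter> B \<subseteq> {Min B}"
        proof
          fix a assume a: "a \<in> S \<inter> B"
          then obtain D where D: "D \<in> P" "a = Min D" using True unfolding S_def by auto
          then have "a \<in> D" using P by (auto simp: partition_on_def intro!: Min_in)
          then have "D = B" using a B D(1) block_eq by blast
          then show "a \<in> {Min B}" using D(2) by simp
        qed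
      qed
      then show ?thesis by simp
    next
      case False
      have "S \<inter> B = A x \<inter> B"
      proof -
        have "Min D \<notin> B" if D: "D \<in> P" "A x \<inter> D = {}" for D
        proof
          assume "Min D \<in> B"
          moreover have "Min D \<in> D" using D P by (auto simp: partition_on_def intro!: Min_in)
          ultimately have "D = B" using D(1) B block_eq by blast
          with D(2) False show False by simp
        qed
        then show ?thesis unfolding S_def by auto
      qed
      moreover have "card (A x \<inter> B) \<le> 1"
        by (rule inj_on_imp_card_le_one[OF x]) (metis B block_eq h_def)
      moreover have "card (A x \<inter> B) \<noteq> 0" using False P(2) B by auto
      ultimately show ?thesis by simp
    qed
    moreover have "S \<in> U"
    proof -
      have "A x - S = {}" unfolding S_def by auto
      then show ?thesis using ideal_finite[OF J] unfolding U_def by (metis finite.emptyI mem_Collect_eq)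
    qed
    ultimately show ?thesis by blast
  qed
  then have "Q_point U" using ultra unfolding Q_point_def by blast
  then show thesis using positive by (intro that) auto
qed

lemma not_point_for_if_disjoint:
  assumes "ultrafilter U" "U \<inter> J = {}"
  shows "\<not> point_for J U"
proof -
  have "B \<in> dual_ideal U" if "B \<in> J" for B
  proof -
    have "- B \<in> U" using assms that unfolding ultrafilter_def by blast
    then show ?thesis unfolding dual_ideal_def by (metis (mono_tags) double_complement mem_Collect_eq)
  qed
  then have "P_le UNIV J UNIV (dual_ideal U)"
    unfolding P_le_def by (intro exI[of _ id]) auto
  then show ?thesis unfolding point_for_def by simp
qed

lemma Q_point_equivalences:
  assumes J: "ideal_on UNIV J" and hom: "KB_homogeneous UNIV J"
    and bounded: "small_families_bounded J"
  shows "(\<not> KB_le ED_Fin_dom ED_Fin UNIV J \<longleftrightarrow> (\<exists>U. Q_point U \<and> \<not> point_for J U)) \<and>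
    ((\<exists>U. Q_point U \<and> \<not> point_for J U) \<longleftrightarrow> (\<exists>U. Q_point U \<and> \<not> weak_ultrafilter_for J U))"
proof -
  have ab: "\<exists>U. Q_point U \<and> \<not> point_for J U" if a: "\<not> KB_le ED_Fin_dom ED_Fin UNIV J"
  proof -
    have "\<exists>B\<subseteq>A. B \<notin> J \<and> inj_on h B"
      if "A \<notin> J" "\<And>n::nat. finite (h -` {n})" for A and h :: "nat \<Rightarrow> nat"
    proof -
      have "KB_le A (restr_ideal J A) UNIV J"
        using hom that(1) unfolding KB_homogeneous_def positive_sets_def by blast
      then have "\<not> KB_le ED_Fin_dom ED_Fin A (restr_ideal J A)" using a KB_le_trans by blast
      then show ?thesis using positive_selector[OF J that(2)] by blast
    qed
    then obtain U where U: "Q_point U" "U \<inter> J = {}"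
      using Q_point_of_positive_sets[OF J bounded] by metis
    then have "\<not> point_for J U"
      using not_point_for_if_disjoint unfolding Q_point_def by blast
    with U(1) show ?thesis by blast
  qed
  have bc: "\<not> weak_ultrafilter_for J U" if "Q_point U" "\<not> point_for J U" for U
    using that P_le_imp_KB_le unfolding Q_point_def point_for_def weak_ultrafilter_for_def by blast
  have ca: "\<not> KB_le ED_Fin_dom ED_Fin UNIV J" if "Q_point U" "\<not> weak_ultrafilter_for J U" for U
  proof
    assume "KB_le ED_Fin_dom ED_Fin UNIV J"
    moreover have "KB_le UNIV J UNIV (dual_ideal U)"
      using that unfolding Q_point_def weak_ultrafilter_for_def by blast
    ultimately have "KB_le ED_Fin_dom ED_Fin UNIV (dual_ideal U)" by (rule KB_le_trans)
    then show False using Q_point_not_above_ED_Fin[OF that(1)] by blast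
  qed
  show ?thesis using ab bc ca by blast
qed

theorem theorem8p5:
  fixes J :: "nat set set"
  assumes "ideal_on UNIV J"
    and "P_plus_ideal UNIV J"
    and "KB_homogeneous UNIV J"
  shows
    "(CH \<longrightarrow>
        (\<not> KB_le ED_Fin_dom ED_Fin UNIV J \<longleftrightarrow> (\<exists>U. Q_point U \<and> \<not> point_for J U)) \<and>
        ((\<exists>U. Q_point U \<and> \<not> point_for J U) \<longleftrightarrow> (\<exists>U. Q_point U \<and> \<not> weak_ultrafilter_for J U)))
     \<and>
     (F_sigma_family J \<and> pseudointersection_number =o continuum \<longrightarrow>
        (\<not> KB_le ED_Fin_dom ED_Fin UNIV J \<longleftrightarrow> (\<exists>U. Q_point U \<and> \<not> point_for J U)) \<and>
        ((\<exists>U. Q_point U \<and> \<not> point_for J U) \<longleftrightarrow> (\<exists>U. Q_point U \<and> \<not> weak_ultrafilter_for J U)))"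
  using Q_point_equivalences[OF assms(1,3)]
    CH_imp_small_families_bounded[OF _ assms(1,2)]
    F_sigma_imp_small_families_bounded[OF assms(1)] by blast

end
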